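(* Let $\{M_0(t)\}_{t\ge0}$ and $\{M(t)\}_{t\ge0}$ be independent generalized counting processes with positive rates $\mu_1,\dots,\mu_{k_0}$ and $\lambda_1,\dots,\lambda_k$, respectively, let $\hat M(t)=M(M_0(t))$, and let $\mu=\sum_{j_0=1}^{k_0}\mu_{j_0}$, $\lambda=\sum_{j=1}^{k}\lambda_j$. The state probabilities $\hat p(n,t)=\mathrm{Pr}\{\hat M(t)=n\}$, $n\ge0$, satisfy $$\frac{\mathrm{d}}{\mathrm{d}t}\hat p(n,t)=-\mu\,\hat p(n,t)+\sum_{j_0=1}^{k_0}\mu_{j_0}e^{-j_0\lambda}\sum_{m=0}^{n}\sum_{\Omega(k,m)}\Big(\prod_{j=1}^{k}\frac{(j_0\lambda_j)^{x_j}}{x_j!}\Big)\hat p(n-m,t),\qquad n\ge0,$$ with initial condition $\hat p(n,0)=1$ if $n=0$ and $\hat p(n,0)=0$ if $n\ge1$.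
   Context: A generalized counting process (GCP) $\{M(t)\}_{t\ge0}$ with positive rates $\lambda_1,\dots,\lambda_k$ is a right-continuous $\mathbb{N}_0$-valued process with $M(0)=0$ and stationary independent increments, whose probability generating function is $\mathbb{E}(u^{M(t)})=\exp\big(-t\sum_{j=1}^{k}\lambda_j(1-u^j)\big)$, $|u|\le1$. The process $\hat M(t)=M(M_0(t))$ is called the iterated generalized counting process (IGCP). The set $\Omega(k,m)=\{(x_1,\dots,x_k)\in\mathbb{N}_0^k: x_1+2x_2+\dots+kx_k=m\}$, and the sum over $\Omega(k,m)$ runs over all $(x_1,\dots,x_k)$ in it. *)

theory Defs
  imports "HOL-Probability.Probability"
begin

text \<open>
  Time is modelled by \<^typ>\<open>real\<close>; only the values of a process at times \<open>t \<ge> 0\<close> matter.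
  Rates \<open>r\<^sub>1, \<dots>, r\<^sub>k\<close> are given by a function of which only the values on \<open>{1..k}\<close> matter.
\<close>

context prob_space
begin

text \<open>Increments are taken in \<^typ>\<open>int\<close>, because subtraction on \<^typ>\<open>nat\<close> truncates.\<close>

definition increment :: "(real \<Rightarrow> 'a \<Rightarrow> nat) \<Rightarrow> real \<Rightarrow> real \<Rightarrow> 'a \<Rightarrow> int" where
  "increment X s t \<omega> = int (X t \<omega>) - int (X s \<omega>)"

definition stationary_increments :: "(real \<Rightarrow> 'a \<Rightarrow> nat) \<Rightarrow> bool" where
  "stationary_increments X \<longleftrightarrow>
     (\<forall>s t h. 0 \<le> s \<and> s \<le> t \<and> 0 \<le> h \<longrightarrow>
        distr M (count_space UNIV) (increment X (s + h) (t + h)) =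
        distr M (count_space UNIV) (increment X s t))"

definition independent_increments :: "(real \<Rightarrow> 'a \<Rightarrow> nat) \<Rightarrow> bool" where
  "independent_increments X \<longleftrightarrow>
     (\<forall>n \<tau>. 0 \<le> \<tau> 0 \<and> (\<forall>i<n. \<tau> i < \<tau> (Suc i)) \<longrightarrow>
        indep_vars (\<lambda>_. count_space UNIV) (\<lambda>i. increment X (\<tau> i) (\<tau> (Suc i))) {..<n::nat})"

text \<open>
  The conditions on sample paths are only required almost surely. Right-continuity refers to the
  discrete topology on \<^typ>\<open>nat\<close>.
\<close>

definition generalized_counting_process ::
    "nat \<Rightarrow> (nat \<Rightarrow> real) \<Rightarrow> (real \<Rightarrow> 'a \<Rightarrow> nat) \<Rightarrow> bool" where
  "generalized_counting_process k r X \<longleftrightarrow>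
     1 \<le> k \<and> (\<forall>j\<in>{1..k}. 0 < r j) \<and>
     (\<forall>t\<ge>0. random_variable (count_space UNIV) (X t)) \<and>
     (AE \<omega> in M. \<forall>t\<ge>0. continuous (at_right t) (\<lambda>s. X s \<omega>)) \<and>
     (AE \<omega> in M. X 0 \<omega> = 0) \<and>
     stationary_increments X \<and>
     independent_increments X \<and>
     (\<forall>t\<ge>0. \<forall>u::real. \<bar>u\<bar> \<le> 1 \<longrightarrow>
        expectation (\<lambda>\<omega>. u ^ X t \<omega>) = exp (- t * (\<Sum>j=1..k. r j * (1 - u ^ j))))"

text \<open>Independence of the whole families \<open>(X\<^sub>t)\<close> and \<open>(Y\<^sub>t)\<close>, \<open>t \<ge> 0\<close>, not just of their marginals.\<close>

definition independent_processes ::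
    "(real \<Rightarrow> 'a \<Rightarrow> nat) \<Rightarrow> (real \<Rightarrow> 'a \<Rightarrow> nat) \<Rightarrow> bool" where
  "independent_processes X Y \<longleftrightarrow>
     indep_var (PiM {0..} (\<lambda>_. count_space UNIV)) (\<lambda>\<omega>. \<lambda>t\<in>{0..}. X t \<omega>)
               (PiM {0..} (\<lambda>_. count_space UNIV)) (\<lambda>\<omega>. \<lambda>t\<in>{0..}. Y t \<omega>)"

definition state_prob :: "(real \<Rightarrow> 'a \<Rightarrow> nat) \<Rightarrow> nat \<Rightarrow> real \<Rightarrow> real" where
  "state_prob X n t = prob {\<omega> \<in> space M. X t \<omega> = n}"

end

definition iterated_process ::
    "(real \<Rightarrow> 'a \<Rightarrow> nat) \<Rightarrow> (real \<Rightarrow> 'a \<Rightarrow> nat) \<Rightarrow> real \<Rightarrow> 'a \<Rightarrow> nat" where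
  "iterated_process X X\<^sub>0 t \<omega> = X (real (X\<^sub>0 t \<omega>)) \<omega>"

text \<open>
  A \<open>k\<close>-tuple is an extensional function on \<open>{1..k}\<close>, so that each tuple is counted exactly once
  and the set is finite.
\<close>

definition Omega :: "nat \<Rightarrow> nat \<Rightarrow> (nat \<Rightarrow> nat) set" where
  "Omega k m = {x \<in> {1..k} \<rightarrow>\<^sub>E UNIV. (\<Sum>j=1..k. j * x j) = m}"

lemma finite_Omega: "finite (Omega k m)"
proof (rule finite_subset)
  show "Omega k m \<subseteq> {1..k} \<rightarrow>\<^sub>E {..m}"
  proof
    fix x assume "x \<in> Omega k m"
    then have x: "x \<in> {1..k} \<rightarrow>\<^sub>E UNIV" and s: "(\<Sum>j=1..k. j * x j) = m"
      by (auto simp: Omega_def)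
    have "x j \<le> m" if j: "j \<in> {1..k}" for j
    proof -
      have "x j \<le> j * x j" using j by simp
      also have "\<dots> \<le> (\<Sum>j=1..k. j * x j)"
        using j by (intro member_le_sum) auto
      finally show ?thesis using s by simp
    qed
    with x show "x \<in> {1..k} \<rightarrow>\<^sub>E {..m}" by (auto simp: PiE_iff)
  qed
qed (auto intro: finite_PiE)

end

(*
  For |u| <= 1, conditioning on M_0(t) gives E(u^(M(M_0(t)))) = exp(t (C(u) - mu)), where
  C(u) = sum_j0 mu_j0 exp(-j0 sum_j lambda_j (1 - u^j)). Hence p(., t) is the coefficient sequence
  of the formal power series F_t = exp(t (C - mu)), whose coefficients can be differentiated in t
  one by one: F_t' = (C - mu) F_t. Reading off coefficients yields the equations, since
  exp(j0 sum_j lambda_j u^j) is a product of exponential series in the u^j, with coefficient sums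
  over Omega(k, m).
*)
theory Submission
  imports Defs "HOL-Complex_Analysis.Complex_Analysis"
begin

unbundle no vec_syntax and fps_syntax

section \<open>Power series expansions of real functions\<close>

text \<open>Otherwise dividing the zero function by \<open>x ^ subdegree D\<close>, where
  \<open>D = F - G\<close>, gives a function whose expansion has the constant term
  \<open>c \<noteq> 0\<close>. It is continuous at 0 with value \<open>c\<close>, yet vanishes
  everywhere else.\<close>

lemma has_fps_expansion_unique_real:
  fixes F G :: "real fps"
  assumes "f has_fps_expansion F" "f has_fps_expansion G"
  shows   "F = G"
proof (rule ccontr)
  assume "F \<noteq> G"
  define D where "D = F - G"
  define c where "c = D $ subdegree D"
  have "D \<noteq> 0" using \<open>F \<noteq> G\<close> by (simp add: D_def)
  then have "c \<noteq> 0" by (simp add: c_def)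
  have "(\<lambda>_. 0) has_fps_expansion D"
    using has_fps_expansion_diff[OF assms] by (simp add: D_def)
  then have "(\<lambda>x. if x = 0 then c else 0 / x ^ subdegree D) has_fps_expansion fps_shift (subdegree D) D"
    by (rule has_fps_expansion_shift) (auto simp: c_def)
  then have "isCont (\<lambda>x. if x = 0 then c else 0 / x ^ subdegree D) 0"
    using has_fps_expansion_imp_continuous by blast
  then have "((\<lambda>x. if x = 0 then c else 0 / x ^ subdegree D) \<longlongrightarrow> c) (at (0::real))"
    by (simp add: isCont_def)
  moreover have "((\<lambda>x. if x = 0 then c else 0 / x ^ subdegree D) \<longlongrightarrow> 0) (at (0::real))"
    by (rule tendsto_eventually) (auto simp: eventually_at_filter)
  ultimately have "c = 0"
    using tendsto_unique[of "at (0::real)"] by (metis at_neq_bot)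
  with \<open>c \<noteq> 0\<close> show False by simp
qed

text \<open>The embedding through which composition of expansions passes from complex to real
  functions.\<close>

definition complex_fps :: "real fps \<Rightarrow> complex fps" where
  "complex_fps F = Abs_fps (\<lambda>n. complex_of_real (F $ n))"

lemma complex_fps_nth [simp]: "complex_fps F $ n = complex_of_real (F $ n)"
  by (simp add: complex_fps_def)

lemma complex_fps_power: "complex_fps F ^ n = complex_fps (F ^ n)"
  by (induction n) (auto simp: fps_eq_iff fps_mult_nth)

lemma complex_fps_compose: "complex_fps F oo complex_fps G = complex_fps (F oo G)"
  by (simp add: fps_eq_iff fps_compose_nth complex_fps_power)

text \<open>The radius of convergence depends only on the norms of the coefficients.\<close>

lemma fps_conv_radius_complex_fps [simp]: "fps_conv_radius (complex_fps F) = fps_conv_radius F"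
  by (simp add: fps_conv_radius_def conv_radius_def)

lemma eval_complex_fps:
  assumes "ereal \<bar>u\<bar> < fps_conv_radius F"
  shows   "eval_fps (complex_fps F) (of_real u) = of_real (eval_fps F u)"
proof -
  have "(\<lambda>n. F $ n * u ^ n) sums eval_fps F u"
    using assms by (intro sums_eval_fps) auto
  then have "(\<lambda>n. complex_of_real (F $ n * u ^ n)) sums of_real (eval_fps F u)"
    by (rule sums_of_real)
  then show ?thesis
    by (simp add: eval_fps_def sums_iff)
qed

lemma eventually_less_fps_conv_radius:
  fixes F :: "real fps"
  assumes "fps_conv_radius F > 0"
  shows   "eventually (\<lambda>u. ereal \<bar>u\<bar> < fps_conv_radius F) (nhds 0)"
proof -
  have "eventually (\<lambda>u. u \<in> eball (0::real) (fps_conv_radius F)) (nhds 0)"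
    using assms by (intro eventually_nhds_in_open) (auto simp: zero_ereal_def)
  then show ?thesis
    by (simp add: in_eball_iff)
qed

text \<open>The library proves this by analyticity, hence for complex functions only.\<close>

lemma has_fps_expansion_compose_real:
  fixes f g :: "real \<Rightarrow> real"
  assumes F: "f has_fps_expansion F"
    and G: "g has_fps_expansion G" "G $ 0 = 0"
  shows   "(\<lambda>u. f (g u)) has_fps_expansion (F oo G)"
proof -
  let ?f = "eval_fps (complex_fps F)" and ?g = "eval_fps (complex_fps G)"
  have rF: "fps_conv_radius F > 0" and rG: "fps_conv_radius G > 0"
    and eF: "eventually (\<lambda>u. eval_fps F u = f u) (nhds 0)"
    and eG: "eventually (\<lambda>u. eval_fps G u = g u) (nhds 0)"
    using F G by (auto simp: has_fps_expansion_def)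
  have FG: "(?f \<circ> ?g) has_fps_expansion complex_fps (F oo G)"
    unfolding complex_fps_compose[symmetric] using rF rG G
    by (intro has_fps_expansion_compose eval_fps_has_fps_expansion) auto
  then have rFG: "fps_conv_radius (F oo G) > 0"
    by (simp add: has_fps_expansion_def)
  \<comment> \<open>Being continuous at 0 with value 0, \<open>g\<close> maps small \<open>u\<close>
    into the disc of convergence of \<open>F\<close>.\<close>
  have "g 0 = 0"
    using eventually_nhds_x_imp_x[OF eG] G by (simp add: eval_fps_at_0)
  moreover have "isCont g 0"
    using has_fps_expansion_imp_continuous[OF G(1)] by simp
  ultimately have lim: "filterlim g (nhds 0) (nhds 0)"
    using tendsto_at_iff_tendsto_nhds[of g 0] by (simp add: isCont_def)
  have limc: "filterlim complex_of_real (nhds 0) (nhds 0)"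
    using tendsto_of_real[OF filterlim_ident[of "nhds 0"]] by simp
  \<comment> \<open>The complex identity is pulled back along the embedding of the reals. Near 0 all
    three series converge at the points concerned, so their complex versions take the embedded real
    values.\<close>
  have "eventually (\<lambda>u. eval_fps (F oo G) u = f (g u)) (nhds 0)"
    using eventually_compose_filterlim[OF conjunct2[OF FG[unfolded has_fps_expansion_def]] limc]
      eG eventually_compose_filterlim[OF eF lim]
      eventually_less_fps_conv_radius[OF rFG] eventually_less_fps_conv_radius[OF rG]
      eventually_compose_filterlim[OF eventually_less_fps_conv_radius[OF rF] lim]
  proof eventually_elim
    case (elim u)
    have "complex_of_real (eval_fps (F oo G) u) = ?f (?g (of_real u))"
      using elim by (simp add: eval_complex_fps)
    also have "\<dots> = of_real (f (g u))"
      using elim by (simp add: eval_complex_fps)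
    finally show ?case
      by (simp only: of_real_eq_iff)
  qed
  with rFG show ?thesis
    by (simp add: has_fps_expansion_def)
qed

section \<open>Exponentials of formal power series and their derivatives in \<open>t\<close>\<close>

text \<open>
  The formal power series \<open>exp (t C)\<close>. Composition is only meaningful with series without constant
  term, so the constant term of \<open>C\<close> is split off.
\<close>

definition fps_exp_mult :: "real fps \<Rightarrow> real \<Rightarrow> real fps" where
  "fps_exp_mult C t = fps_const (exp (t * C $ 0)) * (fps_exp t oo (C - fps_const (C $ 0)))"

text \<open>The factor \<open>exp (t * C $ 0)\<close> splits off from \<open>exp (t * f u)\<close>;
  what remains is the exponential of a function whose series has no constant term.\<close>

lemma has_fps_expansion_exp_mult:
  assumes "f has_fps_expansion C"
  shows   "(\<lambda>u. exp (t * f u)) has_fps_expansion fps_exp_mult C t"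
proof -
  let ?c = "C $ 0"
  have "(\<lambda>u. exp (t * ?c) * exp (t * (f u - ?c))) has_fps_expansion fps_exp_mult C t"
    unfolding fps_exp_mult_def
    by (intro has_fps_expansion_cmult_left has_fps_expansion_diff assms has_fps_expansion_const
        has_fps_expansion_compose_real[where f = "\<lambda>x. exp (t * x)"] has_fps_expansion_exp) auto
  then show ?thesis
    by (simp add: exp_add[symmetric] algebra_simps)
qed

lemma fps_exp_mult_0: "fps_exp_mult C 0 = 1"
  by (simp add: fps_exp_mult_def)

text \<open>Each coefficient of the composition is a finite sum over \<open>i \<le> n\<close>, hence
  a polynomial in \<open>t\<close>. The derivative of \<open>t ^ i / fact i\<close> is coefficient
  \<open>i\<close> of \<open>fps_X * fps_exp t\<close>, and composition with \<open>A\<close> turns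
  the factor \<open>fps_X\<close> into \<open>A\<close>.\<close>

lemma fps_exp_compose_nth_deriv:
  fixes A :: "real fps"
  assumes "A $ 0 = 0"
  shows   "((\<lambda>t. (fps_exp t oo A) $ n) has_real_derivative (A * (fps_exp t oo A)) $ n) (at t within S)"
proof -
  have "((\<lambda>t. \<Sum>i=0..n. t ^ i / fact i * (A ^ i) $ n) has_real_derivative
          (\<Sum>i=0..n. (fps_X * fps_exp t) $ i * (A ^ i) $ n)) (at t within S)"
  proof (rule DERIV_sum)
    fix i
    have "real i * t ^ (i - Suc 0) / fact i = (fps_X * fps_exp t) $ i"
      by (cases i) (auto simp del: of_nat_Suc)
    \<comment> \<open>At \<open>i = 0\<close> the truncated exponent is harmless, because the factor
      \<open>real i\<close> is 0.\<close>
    moreover have "((\<lambda>t. t ^ i / fact i) has_real_derivative real i * t ^ (i - Suc 0) / fact i)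
            (at t within S)"
      by (auto intro!: derivative_eq_intros)
    ultimately show "((\<lambda>t. t ^ i / fact i * (A ^ i) $ n) has_real_derivative
            (fps_X * fps_exp t) $ i * (A ^ i) $ n) (at t within S)"
      by (simp only: DERIV_cmult_right)
  qed
  also have "(\<Sum>i=0..n. (fps_X * fps_exp t) $ i * (A ^ i) $ n) = ((fps_X * fps_exp t) oo A) $ n"
    by (simp add: fps_compose_nth)
  also have "(fps_X * fps_exp t) oo A = A * (fps_exp t oo A)"
    using assms by (simp add: fps_compose_mult_distrib)
  finally show ?thesis
    by (simp add: fps_compose_nth)
qed

text \<open>Product rule: the scalar factor contributes the constant term of \<open>C\<close>, the
  composed factor the rest \<open>A\<close>.\<close>

lemma fps_exp_mult_nth_deriv:
  "((\<lambda>t. fps_exp_mult C t $ n) has_real_derivative (C * fps_exp_mult C t) $ n) (at t within S)"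
proof -
  define A where "A = C - fps_const (C $ 0)"
  have C: "C = fps_const (C $ 0) + A"
    by (simp add: A_def)
  have "((\<lambda>t. exp (t * C $ 0) * (fps_exp t oo A) $ n) has_real_derivative
           exp (t * C $ 0) * C $ 0 * (fps_exp t oo A) $ n
           + exp (t * C $ 0) * (A * (fps_exp t oo A)) $ n) (at t within S)"
    by (auto intro!: derivative_eq_intros fps_exp_compose_nth_deriv simp: A_def)
  also have "exp (t * C $ 0) * C $ 0 * (fps_exp t oo A) $ n
           + exp (t * C $ 0) * (A * (fps_exp t oo A)) $ n
       = ((fps_const (C $ 0) + A) * (fps_const (exp (t * C $ 0)) * (fps_exp t oo A))) $ n"
    by (simp add: distrib_right mult.left_commute[of A])
  finally show ?thesis
    unfolding fps_exp_mult_def using C by (simp add: A_def)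
qed

section \<open>Sums over \<open>Omega\<close> as coefficients of power series\<close>

text \<open>Here \<open>i = Suc k * x (Suc k)\<close> is the share of \<open>m\<close> taken by the
  last component. Summing over \<open>i\<close> with a divisibility test, rather than over
  \<open>x (Suc k)\<close>, gives the right-hand side the shape of a Cauchy product.\<close>

lemma sum_Omega_Suc:
  fixes f :: "nat \<Rightarrow> nat \<Rightarrow> real"
  shows "(\<Sum>x\<in>Omega (Suc k) m. \<Prod>j=1..Suc k. f j (x j)) =
         (\<Sum>i=0..m. (if Suc k dvd i then f (Suc k) (i div Suc k) else 0) *
            (\<Sum>x\<in>Omega k (m - i). \<Prod>j=1..k. f j (x j)))"
proof -
  define B where "B = (\<lambda>i. if Suc k dvd i then Omega k (m - i) else {})"
  have "(\<Sum>x\<in>Omega (Suc k) m. \<Prod>j=1..Suc k. f j (x j)) =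
        (\<Sum>(i, x)\<in>Sigma {0..m} B. f (Suc k) (i div Suc k) * (\<Prod>j=1..k. f j (x j)))"
  \<comment> \<open>The last component is split off and reset to \<open>undefined\<close>, as tuples
    in \<open>Omega k\<close> are extensional on \<open>{1..k}\<close>.\<close>
  proof (rule sum.reindex_bij_witness[where
        i = "\<lambda>(i, x). x(Suc k := i div Suc k)" and
        j = "\<lambda>x. (Suc k * x (Suc k), x(Suc k := undefined))"], goal_cases)
    case (1 x)
    then show ?case by (simp del: mult_Suc)
  next
    case (2 x)
    then have x: "x \<in> {1..Suc k} \<rightarrow>\<^sub>E UNIV" and s: "(\<Sum>j=1..Suc k. j * x j) = m"
      by (auto simp: Omega_def)
    have s': "(\<Sum>j=1..k. j * x j) + Suc k * x (Suc k) = m"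
      using s by (simp add: sum.cl_ivl_Suc)
    have "(\<Sum>j=1..k. j * (x(Suc k := undefined)) j) = (\<Sum>j=1..k. j * x j)"
      by (intro sum.cong) auto
    then have "(\<Sum>j=1..k. j * (x(Suc k := undefined)) j) = m - Suc k * x (Suc k)"
      using s' by linarith
    moreover have "x(Suc k := undefined) \<in> {1..k} \<rightarrow>\<^sub>E UNIV"
      using x by (auto simp: PiE_iff extensional_def)
    ultimately have "x(Suc k := undefined) \<in> B (Suc k * x (Suc k))"
      by (simp add: B_def Omega_def del: mult_Suc)
    then show ?case
      using s' by (simp del: mult_Suc)
  next
    case (3 ix)
    obtain i x where ix: "ix = (i, x)" by force
    from 3 ix have x: "x \<in> Omega k (m - i)" and i: "i \<le> m" "Suc k dvd i"
      by (auto simp: B_def split: if_splits)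
    have "x (Suc k) = undefined"
      using x by (auto simp: Omega_def PiE_iff extensional_def)
    with i show ?case
      by (auto simp: ix fun_eq_iff simp del: mult_Suc)
  next
    case (4 ix)
    obtain i x where ix: "ix = (i, x)" by force
    from 4 ix have x: "x \<in> Omega k (m - i)" and i: "i \<le> m" "Suc k dvd i"
      by (auto simp: B_def split: if_splits)
    have "(\<Sum>j=1..k. j * (x(Suc k := i div Suc k)) j) = (\<Sum>j=1..k. j * x j)"
      by (intro sum.cong) auto
    with x i have "(\<Sum>j=1..Suc k. j * (x(Suc k := i div Suc k)) j) = m"
      by (simp add: Omega_def sum.cl_ivl_Suc del: mult_Suc)
    moreover have "x(Suc k := i div Suc k) \<in> {1..Suc k} \<rightarrow>\<^sub>E UNIV"
      using x by (auto simp: Omega_def PiE_iff extensional_def)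
    ultimately show ?case
      by (simp add: ix Omega_def)
  next
    case (5 x)
    have "(\<Prod>j=1..k. f j ((x(Suc k := undefined)) j)) = (\<Prod>j=1..k. f j (x j))"
      by (intro prod.cong) auto
    then show ?case
      by (simp add: mult.commute del: mult_Suc)
  qed
  also have "\<dots> = (\<Sum>i=0..m. \<Sum>x\<in>B i. f (Suc k) (i div Suc k) * (\<Prod>j=1..k. f j (x j)))"
    by (subst sum.Sigma) (auto simp: B_def finite_Omega)
  also have "\<dots> = (\<Sum>i=0..m. (if Suc k dvd i then f (Suc k) (i div Suc k) else 0) *
            (\<Sum>x\<in>Omega k (m - i). \<Prod>j=1..k. f j (x j)))"
    by (intro sum.cong) (auto simp: B_def sum_distrib_left)
  finally show ?thesis .
qed

text \<open>The new factor has nonzero coefficients only at multiples of \<open>Suc k\<close>, so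
  multiplying by it is exactly the recursion \<open>sum_Omega_Suc\<close>.\<close>

lemma prod_fps_exp_power_nth:
  fixes a :: "nat \<Rightarrow> real"
  shows "(\<Prod>j=1..k. fps_exp (a j) oo fps_X ^ j) $ m =
         (\<Sum>x\<in>Omega k m. \<Prod>j=1..k. a j ^ x j / fact (x j))"
proof (induction k arbitrary: m)
  case 0
  \<comment> \<open>The empty tuple is the only candidate, and its weighted sum is 0.\<close>
  have "Omega 0 m = (if m = 0 then {\<lambda>_. undefined} else {})"
    by (auto simp: Omega_def)
  then show ?case by simp
next
  case (Suc k)
  let ?e = "fps_exp (a (Suc k)) oo fps_X ^ Suc k"
  have "(\<Prod>j=1..Suc k. fps_exp (a j) oo fps_X ^ j) = ?e * (\<Prod>j=1..k. fps_exp (a j) oo fps_X ^ j)"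
    by (simp add: mult.commute)
  then have "(\<Prod>j=1..Suc k. fps_exp (a j) oo fps_X ^ j) $ m =
      (\<Sum>i=0..m. ?e $ i * (\<Sum>x\<in>Omega k (m - i). \<Prod>j=1..k. a j ^ x j / fact (x j)))"
    by (simp only: fps_mult_nth Suc.IH)
  also have "\<dots> = (\<Sum>x\<in>Omega (Suc k) m. \<Prod>j=1..Suc k. a j ^ x j / fact (x j))"
    unfolding sum_Omega_Suc[where f = "\<lambda>j n. a j ^ n / fact n"] fps_nth_compose_X_power
    by (intro sum.cong) auto
  finally show ?case .
qed

section \<open>Probability generating functions\<close>

context prob_space
begin

text \<open>Decomposition by the value of \<open>N\<close>: for each outcome only the term
  \<open>l = N \<omega>\<close> survives. The terms are dominated in mean by the summable
  probabilities of \<open>N = l\<close>, which justifies exchanging sum and expectation.\<close>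

lemma expectation_sums_by_nat_value:
  fixes N :: "'a \<Rightarrow> nat" and Y :: "nat \<Rightarrow> 'a \<Rightarrow> real"
  assumes N [measurable]: "random_variable (count_space UNIV) N"
    and Y [measurable]: "\<And>l. random_variable borel (Y l)"
    and bound: "\<And>l \<omega>. \<bar>Y l \<omega>\<bar> \<le> 1"
  shows "(\<lambda>l. expectation (\<lambda>\<omega>. indicator {l} (N \<omega>) * Y l \<omega>)) sums expectation (\<lambda>\<omega>. Y (N \<omega>) \<omega>)"
proof -
  have sums: "(\<lambda>l. indicator {l} (N \<omega>) * f l) sums f (N \<omega>)" for \<omega> and f :: "nat \<Rightarrow> real"
    using sums_single[of "N \<omega>" f] by (rule sums_cong[THEN iffD1, rotated]) (auto simp: indicator_def)
  have int: "integrable M (\<lambda>\<omega>. indicator {l} (N \<omega>) * Y l \<omega>)" for l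
    by (rule integrable_const_bound[where B = 1]) (use bound in \<open>auto simp: indicator_def\<close>)
  have meas: "{\<omega> \<in> space M. N \<omega> = l} \<in> events" for l
    by measurable
  have "(\<lambda>l. prob {\<omega> \<in> space M. N \<omega> = l}) sums prob (\<Union>l. {\<omega> \<in> space M. N \<omega> = l})"
    by (rule finite_measure_UNION) (use meas in \<open>auto simp: disjoint_family_on_def\<close>)
  then have summ: "summable (\<lambda>l. prob {\<omega> \<in> space M. N \<omega> = l})"
    by (simp add: sums_iff)
  have "(\<lambda>l. expectation (\<lambda>\<omega>. indicator {l} (N \<omega>) * Y l \<omega>)) sums
        expectation (\<lambda>\<omega>. \<Sum>l. indicator {l} (N \<omega>) * Y l \<omega>)"
  proof (rule sums_integral[OF int])
    show "AE \<omega> in M. summable (\<lambda>l. norm (indicator {l} (N \<omega>) * Y l \<omega>))"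
      using sums[of _ "\<lambda>l. \<bar>Y l _\<bar>"] by (intro AE_I2) (auto simp: abs_mult sums_iff)
    have "expectation (\<lambda>\<omega>. norm (indicator {l} (N \<omega>) * Y l \<omega>)) \<le> prob {\<omega> \<in> space M. N \<omega> = l}" for l
    proof -
      have "expectation (\<lambda>\<omega>. norm (indicator {l} (N \<omega>) * Y l \<omega>))
              \<le> expectation (indicator {\<omega> \<in> space M. N \<omega> = l})"
        by (rule integral_mono)
           (use int meas bound in \<open>auto simp: indicator_def emeasure_eq_measure intro!: integrable_norm\<close>)
      then show ?thesis using meas by simp
    qed
    then show "summable (\<lambda>l. expectation (\<lambda>\<omega>. norm (indicator {l} (N \<omega>) * Y l \<omega>)))"
      by (intro summable_comparison_test'[OF summ, of 0]) auto
  qed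
  also have "(\<lambda>\<omega>. \<Sum>l. indicator {l} (N \<omega>) * Y l \<omega>) = (\<lambda>\<omega>. Y (N \<omega>) \<omega>)"
    using sums[of _ "\<lambda>l. Y l _"] by (auto simp: sums_iff)
  finally show ?thesis .
qed

lemma expectation_indicator_value:
  assumes "random_variable (count_space UNIV) N"
  shows "expectation (\<lambda>\<omega>. indicator {l} (N \<omega>) :: real) = prob {\<omega> \<in> space M. N \<omega> = l}"
proof -
  have "{\<omega> \<in> space M. N \<omega> = l} \<in> events"
    using assms by measurable
  then have "expectation (indicator {\<omega> \<in> space M. N \<omega> = l}) = prob {\<omega> \<in> space M. N \<omega> = l}"
    by simp
  moreover have "expectation (\<lambda>\<omega>. indicator {l} (N \<omega>) :: real) = expectation (indicator {\<omega> \<in> space M. N \<omega> = l})"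
    by (intro Bochner_Integration.integral_cong) (auto simp: indicator_def)
  ultimately show ?thesis by simp
qed

lemma pgf_sums:
  fixes u :: real
  assumes "random_variable (count_space UNIV) N" "\<bar>u\<bar> \<le> 1"
  shows "(\<lambda>n. prob {\<omega> \<in> space M. N \<omega> = n} * u ^ n) sums expectation (\<lambda>\<omega>. u ^ N \<omega>)"
  using expectation_sums_by_nat_value[of N "\<lambda>l _. u ^ l"] assms
  by (simp add: power_abs power_le_one expectation_indicator_value)

text \<open>Conditioning on \<open>X0 t = l\<close> leaves the generating function of
  \<open>X l\<close>, which is \<open>v ^ l\<close>; summing over \<open>l\<close> gives the
  generating function of \<open>X0 t\<close> at \<open>v\<close>.\<close>

lemma pgf_iterated_process:
  fixes u v :: real
  assumes X0: "random_variable (count_space UNIV) (X0 t)"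
    and X: "\<And>s. 0 \<le> s \<Longrightarrow> random_variable (count_space UNIV) (X s)"
    and indep: "independent_processes X0 X"
    and t: "0 \<le> t" and u: "\<bar>u\<bar> \<le> 1" and v: "\<bar>v\<bar> \<le> 1"
    and pgf: "\<And>l::nat. expectation (\<lambda>\<omega>. u ^ X l \<omega>) = v ^ l"
  shows "expectation (\<lambda>\<omega>. u ^ iterated_process X X0 t \<omega>) = expectation (\<lambda>\<omega>. v ^ X0 t \<omega>)"
proof -
  note [measurable] = X0 X
  have indep_l: "indep_var borel (\<lambda>\<omega>. indicator {l} (X0 t \<omega>) :: real) borel (\<lambda>\<omega>. u ^ X l \<omega>)" for l :: nat
  proof -
    \<comment> \<open>Independence of the whole paths is restricted to the coordinates
      \<open>t\<close> and \<open>real l\<close>.\<close>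
    have "indep_var borel ((\<lambda>f. indicator {l} (f t) :: real) \<circ> (\<lambda>\<omega>. \<lambda>t\<in>{0..}. X0 t \<omega>))
                    borel ((\<lambda>f. u ^ f (real l)) \<circ> (\<lambda>\<omega>. \<lambda>t\<in>{0..}. X t \<omega>))"
      by (rule indep_var_compose[OF indep[unfolded independent_processes_def]])
         (rule measurable_compose[OF measurable_component_singleton], use t in auto)+
    then show ?thesis
      using t by (simp add: o_def)
  qed
  have "expectation (\<lambda>\<omega>. indicator {l} (X0 t \<omega>) * u ^ X l \<omega>) =
        prob {\<omega> \<in> space M. X0 t \<omega> = l} * v ^ l" for l :: nat
  proof -
    have "integrable M (\<lambda>\<omega>. indicator {l} (X0 t \<omega>) :: real)"
      by (rule integrable_const_bound[where B = 1]) (auto simp: indicator_def)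
    moreover have "integrable M (\<lambda>\<omega>. u ^ X l \<omega>)"
      using u by (intro integrable_const_bound[where B = 1]) (auto simp: power_abs power_le_one)
    ultimately show ?thesis
      using indep_l[of l]
      by (simp add: indep_var_lebesgue_integral expectation_indicator_value[OF X0] pgf)
  qed
  moreover have "(\<lambda>l. expectation (\<lambda>\<omega>. indicator {l} (X0 t \<omega>) * u ^ X (real l) \<omega>)) sums
      expectation (\<lambda>\<omega>. u ^ X (real (X0 t \<omega>)) \<omega>)"
    using u by (intro expectation_sums_by_nat_value) (auto simp: power_abs power_le_one)
  ultimately have "(\<lambda>l. prob {\<omega> \<in> space M. X0 t \<omega> = l} * v ^ l) sums
      expectation (\<lambda>\<omega>. u ^ iterated_process X X0 t \<omega>)"
    by (simp add: iterated_process_def)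
  with pgf_sums[OF X0 v] show ?thesis
    using sums_unique2 by blast
qed

text \<open>The random time takes only countably many values.\<close>

lemma iterated_process_measurable:
  assumes X0: "random_variable (count_space UNIV) (X0 t)"
    and X: "\<And>s. 0 \<le> s \<Longrightarrow> random_variable (count_space UNIV) (X s)"
  shows "random_variable (count_space UNIV) (iterated_process X X0 t)"
  unfolding iterated_process_def
  by (rule measurable_compose_countable[OF _ X0]) (simp add: X)

end

section \<open>The differential equations for the state probabilities\<close>

theorem proposition3p2:
  fixes M :: "'a measure"
    and X\<^sub>0 X :: "real \<Rightarrow> 'a \<Rightarrow> nat"
    and k\<^sub>0 k :: nat
    and mu lam :: "nat \<Rightarrow> real"
    and mu_tot lam_tot :: real
    and p :: "nat \<Rightarrow> real \<Rightarrow> real"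
  assumes "prob_space M"
    and "prob_space.generalized_counting_process M k\<^sub>0 mu X\<^sub>0"
    and "prob_space.generalized_counting_process M k lam X"
    and "prob_space.independent_processes M X\<^sub>0 X"
    and "mu_tot = (\<Sum>j\<^sub>0=1..k\<^sub>0. mu j\<^sub>0)"
    and "lam_tot = (\<Sum>j=1..k. lam j)"
    and "\<And>n t. p n t = prob_space.state_prob M (iterated_process X X\<^sub>0) n t"
  shows "(\<forall>n. \<forall>t\<ge>0.
            ((\<lambda>s. p n s) has_real_derivative
              (- mu_tot * p n t +
               (\<Sum>j\<^sub>0=1..k\<^sub>0. mu j\<^sub>0 * exp (- real j\<^sub>0 * lam_tot) *
                 (\<Sum>m=0..n. \<Sum>x\<in>Omega k m.
                   (\<Prod>j=1..k. (real j\<^sub>0 * lam j) ^ x j / fact (x j)) * p (n - m) t)))) (at t within {0..})) \<and>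
         (\<forall>n. p n 0 = (if n = 0 then 1 else 0))"
proof -
  interpret prob_space M by fact
  have X0: "\<And>t. 0 \<le> t \<Longrightarrow> random_variable (count_space UNIV) (X\<^sub>0 t)"
    and X: "\<And>t. 0 \<le> t \<Longrightarrow> random_variable (count_space UNIV) (X t)"
    and lam: "\<And>j. j \<in> {1..k} \<Longrightarrow> 0 < lam j"
    and pgf0: "\<And>t u. 0 \<le> t \<Longrightarrow> \<bar>u\<bar> \<le> 1 \<Longrightarrow>
      expectation (\<lambda>\<omega>. u ^ X\<^sub>0 t \<omega>) = exp (- t * (\<Sum>j=1..k\<^sub>0. mu j * (1 - u ^ j)))"
    and pgf: "\<And>t u. 0 \<le> t \<Longrightarrow> \<bar>u\<bar> \<le> 1 \<Longrightarrow>
      expectation (\<lambda>\<omega>. u ^ X t \<omega>) = exp (- t * (\<Sum>j=1..k. lam j * (1 - u ^ j)))"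
    using assms(2,3) by (auto simp: generalized_counting_process_def)
  \<comment> \<open>\<open>E j\<^sub>0\<close> is the series of the generating function of
    \<open>X\<close> at time \<open>j\<^sub>0\<close>, up to the factor
    \<open>exp (- real j\<^sub>0 * lam_tot)\<close>, which is absorbed into \<open>w\<close>. Both
    \<open>C\<close> and the function \<open>c\<close> it expands include the term
    \<open>- mu_tot\<close>.\<close>
  define w where "w j\<^sub>0 = mu j\<^sub>0 * exp (- real j\<^sub>0 * lam_tot)" for j\<^sub>0
  define E where "E j\<^sub>0 = (\<Prod>j=1..k. fps_exp (real j\<^sub>0 * lam j) oo fps_X ^ j)" for j\<^sub>0
  define C where "C = (\<Sum>j\<^sub>0=1..k\<^sub>0. fps_const (w j\<^sub>0) * E j\<^sub>0) - fps_const mu_tot"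
  define c where "c u = (\<Sum>j\<^sub>0=1..k\<^sub>0. w j\<^sub>0 * (\<Prod>j=1..k. exp (real j\<^sub>0 * lam j * u ^ j))) - mu_tot" for u
  have "c has_fps_expansion C"
    unfolding c_def[abs_def] C_def E_def
    by (intro has_fps_expansion_diff has_fps_expansion_sum has_fps_expansion_cmult_left
        has_fps_expansion_prod has_fps_expansion_const has_fps_expansion_fps_X_power
        has_fps_expansion_compose_real[where f = "\<lambda>x. exp (_ * x)"] has_fps_expansion_exp) auto
  then have exp_c: "(\<lambda>u. exp (t * c u)) has_fps_expansion fps_exp_mult C t" for t
    by (rule has_fps_expansion_exp_mult)

  have pgf_it: "expectation (\<lambda>\<omega>. u ^ iterated_process X X\<^sub>0 t \<omega>) = exp (t * c u)"
    if t: "0 \<le> t" and u: "\<bar>u\<bar> \<le> 1" for t u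
  proof -
    define \<phi> where "\<phi> = (\<Sum>j=1..k. lam j * (1 - u ^ j))"
    \<comment> \<open>This makes \<open>\<phi>\<close> nonnegative, so that
      \<open>exp (- \<phi>)\<close>, the generating function of \<open>X 1\<close> at
      \<open>u\<close>, lies in the range where \<open>pgf0\<close> applies. As \<open>u\<close> may
      be negative, the bound goes through its absolute value.\<close>
    have "u ^ j \<le> 1" for j
      using u power_le_one[of "\<bar>u\<bar>" j] by (metis abs_ge_zero abs_le_D1 power_abs)
    then have "0 \<le> \<phi>"
      unfolding \<phi>_def using lam by (intro sum_nonneg mult_nonneg_nonneg) (auto simp: less_imp_le)
    then have "expectation (\<lambda>\<omega>. u ^ iterated_process X X\<^sub>0 t \<omega>) = expectation (\<lambda>\<omega>. exp (- \<phi>) ^ X\<^sub>0 t \<omega>)"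
      using t u X0 X assms(4) pgf
      by (intro pgf_iterated_process) (auto simp: \<phi>_def exp_of_nat_mult[symmetric])
    also have "\<dots> = exp (- t * (\<Sum>j\<^sub>0=1..k\<^sub>0. mu j\<^sub>0 * (1 - exp (- \<phi>) ^ j\<^sub>0)))"
      using t \<open>0 \<le> \<phi>\<close> by (intro pgf0) auto
    also have "(\<Sum>j\<^sub>0=1..k\<^sub>0. mu j\<^sub>0 * (1 - exp (- \<phi>) ^ j\<^sub>0)) =
        (\<Sum>j\<^sub>0=1..k\<^sub>0. mu j\<^sub>0 - w j\<^sub>0 * (\<Prod>j=1..k. exp (real j\<^sub>0 * lam j * u ^ j)))"
    proof (rule sum.cong[OF refl])
      fix j\<^sub>0
      have "exp (- \<phi>) ^ j\<^sub>0 = exp (- real j\<^sub>0 * lam_tot + (\<Sum>j=1..k. real j\<^sub>0 * lam j * u ^ j))"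
        by (simp add: exp_of_nat_mult[symmetric] \<phi>_def assms(6) sum_distrib_left sum_subtractf
            sum_negf algebra_simps)
      also have "\<dots> = exp (- real j\<^sub>0 * lam_tot) * (\<Prod>j=1..k. exp (real j\<^sub>0 * lam j * u ^ j))"
        by (simp only: exp_add exp_sum finite_atLeastAtMost)
      finally show "mu j\<^sub>0 * (1 - exp (- \<phi>) ^ j\<^sub>0) =
          mu j\<^sub>0 - w j\<^sub>0 * (\<Prod>j=1..k. exp (real j\<^sub>0 * lam j * u ^ j))"
        by (simp add: w_def algebra_simps)
    qed
    also have "- t * (\<Sum>j\<^sub>0=1..k\<^sub>0. mu j\<^sub>0 - w j\<^sub>0 * (\<Prod>j=1..k. exp (real j\<^sub>0 * lam j * u ^ j))) = t * c u"
      by (simp add: c_def sum_subtractf assms(5) algebra_simps)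
    finally show ?thesis .
  qed

  have p_eq: "p n t = fps_exp_mult C t $ n" if t: "0 \<le> t" for n t
  proof -
    \<comment> \<open>On this neighbourhood the probabilities and the coefficients of
      \<open>fps_exp_mult C t\<close> both expand \<open>exp (t * c u)\<close>, so uniqueness
      identifies them.\<close>
    have "eventually (\<lambda>u::real. \<bar>u\<bar> < 1) (nhds 0)"
      using eventually_nhds_in_open[of "ball (0::real) 1" 0] by simp
    then have "eventually (\<lambda>u. (\<lambda>n. p n t * u ^ n) sums exp (t * c u)) (nhds 0)"
    proof eventually_elim
      case (elim u)
      have "random_variable (count_space UNIV) (iterated_process X X\<^sub>0 t)"
        using X0 X t by (intro iterated_process_measurable) auto
      from pgf_sums[OF this, of u] show ?case
        using elim by (simp add: pgf_it[OF t] assms(7) state_prob_def)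
    qed
    then have "(\<lambda>u. exp (t * c u)) has_fps_expansion Abs_fps (\<lambda>n. p n t)"
      by (intro has_fps_expansionI) simp
    then have "Abs_fps (\<lambda>n. p n t) = fps_exp_mult C t"
      using exp_c by (rule has_fps_expansion_unique_real)
    then show ?thesis
      by (metis fps_nth_Abs_fps)
  qed

  have "((\<lambda>s. p n s) has_real_derivative
              (- mu_tot * p n t +
               (\<Sum>j\<^sub>0=1..k\<^sub>0. w j\<^sub>0 *
                 (\<Sum>m=0..n. \<Sum>x\<in>Omega k m.
                   (\<Prod>j=1..k. (real j\<^sub>0 * lam j) ^ x j / fact (x j)) * p (n - m) t)))) (at t within {0..})"
    if t: "0 \<le> t" for n t
  proof -
    let ?F = "fps_exp_mult C t"
    \<comment> \<open>With the \<open>Omega\<close> sum read as coefficient \<open>m\<close> of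
      \<open>E j\<^sub>0\<close>, the sum over \<open>m\<close> becomes the Cauchy product of
      \<open>E j\<^sub>0\<close> and \<open>?F\<close>.\<close>
    have "(\<Sum>x\<in>Omega k m. (\<Prod>j=1..k. (real j\<^sub>0 * lam j) ^ x j / fact (x j)) * p (n - m) t)
        = E j\<^sub>0 $ m * ?F $ (n - m)" for j\<^sub>0 m
      by (simp only: E_def prod_fps_exp_power_nth p_eq[OF t] sum_distrib_right)
    then have "- mu_tot * p n t + (\<Sum>j\<^sub>0=1..k\<^sub>0. w j\<^sub>0 * (\<Sum>m=0..n. \<Sum>x\<in>Omega k m.
          (\<Prod>j=1..k. (real j\<^sub>0 * lam j) ^ x j / fact (x j)) * p (n - m) t))
        = - mu_tot * ?F $ n + (\<Sum>j\<^sub>0=1..k\<^sub>0. w j\<^sub>0 * (E j\<^sub>0 * ?F) $ n)"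
      by (simp add: fps_mult_nth p_eq[OF t])
    also have "\<dots> = (C * ?F) $ n"
      by (simp add: C_def left_diff_distrib sum_distrib_right fps_sum_nth mult.assoc)
    finally have rhs: "- mu_tot * p n t + (\<Sum>j\<^sub>0=1..k\<^sub>0. w j\<^sub>0 * (\<Sum>m=0..n. \<Sum>x\<in>Omega k m.
          (\<Prod>j=1..k. (real j\<^sub>0 * lam j) ^ x j / fact (x j)) * p (n - m) t)) = (C * ?F) $ n" .
    \<comment> \<open>The coefficients agree with \<open>p n\<close> only at nonnegative times, so
      the derivative is transferred within \<open>{0..}\<close>; at \<open>t = 0\<close> it is
      one-sided. The radius 1 is arbitrary.\<close>
    show ?thesis
      unfolding rhs
      by (rule has_field_derivative_transform_within[OF fps_exp_mult_nth_deriv zero_less_one])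
         (use t p_eq in auto)
  qed
  moreover have "p n 0 = (if n = 0 then 1 else 0)" for n
    by (simp add: p_eq fps_exp_mult_0)
  ultimately show ?thesis
    unfolding w_def by blast
qed

end
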